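(* For every $r\ge 1$, the free regular $\star$-monoid $\mathbf{F}_r^\star$ of rank $r$ is not rational. Therefore, for every $r\ge 1$, $\mathbf{F}_r^\star$ is not automatic.
   Context: Let $A$ be a set with $|A|=r$, let $A_\star=\{a^\star : a\in A\}$ be a disjoint copy of $A$, set $(a^\star)^\star=a$, and extend to an involution on words over $A\cup A_\star$ by $(xy)^\star=y^\star x^\star$. The free regular $\star$-monoid of rank $r$, denoted $\mathbf{F}_r^\star$, is the monoid with generators $A\cup A_\star$ and defining relations $ww^\star w=w$ for all words $w\in(A\cup A_\star)^\ast$. A monoid $M$ is rational if there is a regular language of unique normal forms for $M$, i.e. there are a finite generating set $B$ of $M$ and a regular language $L\subseteq B^\ast$ such that every element of $M$ is represented by exactly one word of $L$. A monoid $M$ is automatic if there are a finite generating set $B$ and a regular language $L\subseteq B^\ast$ such that every element of $M$ is represented by at least one word of $L$ and, for $x=1$ and for each $x\in B$, the set of pairs $(u,v)\in L\times L$ with $ux=v$ in $M$ is recognized by a synchronous two-tape finite automaton (where the shorter word of each pair is padded at its right end with a padding symbol). *)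

theory Defs
  imports "HOL-Algebra.Group"
begin

section \<open>Monoid presentations\<close>

inductive_set pres_cong :: "'x set \<Rightarrow> ('x list \<times> 'x list) set \<Rightarrow> ('x list \<times> 'x list) set"
  for X :: "'x set" and R :: "('x list \<times> 'x list) set" where
  refl: "u \<in> lists X \<Longrightarrow> (u, u) \<in> pres_cong X R"
| step: "(s, t) \<in> R \<Longrightarrow> {s, t, p, q} \<subseteq> lists X \<Longrightarrow> (p @ s @ q, p @ t @ q) \<in> pres_cong X R"
| sym: "(u, v) \<in> pres_cong X R \<Longrightarrow> (v, u) \<in> pres_cong X R"
| trans: "(u, v) \<in> pres_cong X R \<Longrightarrow> (v, w) \<in> pres_cong X R \<Longrightarrow> (u, w) \<in> pres_cong X R"

definition presented_monoid :: "'x set \<Rightarrow> ('x list \<times> 'x list) set \<Rightarrow> 'x list set monoid" where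
  "presented_monoid X R =
    \<lparr>carrier = lists X // pres_cong X R,
     mult = (\<lambda>C D. \<Union>u\<in>C. \<Union>v\<in>D. pres_cong X R `` {u @ v}),
     one = pres_cong X R `` {[]}\<rparr>"

lemma pres_cong_lists:
  "(u, v) \<in> pres_cong X R \<Longrightarrow> u \<in> lists X \<and> v \<in> lists X"
  by (induction rule: pres_cong.induct) auto

lemma equiv_pres_cong: "equiv (lists X) (pres_cong X R)"
proof (rule equivI)
  show "pres_cong X R \<subseteq> lists X \<times> lists X"
    using pres_cong_lists by (metis SigmaI subrelI)
  show "refl_on (lists X) (pres_cong X R)"
    by (rule refl_onI) (rule pres_cong.refl)
  show "sym (pres_cong X R)"
    by (rule symI) (rule pres_cong.sym)
  show "trans (pres_cong X R)"
    by (rule transI) (rule pres_cong.trans)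
qed

lemma pres_cong_context:
  assumes "(u, v) \<in> pres_cong X R" "p \<in> lists X" "q \<in> lists X"
  shows "(p @ u @ q, p @ v @ q) \<in> pres_cong X R"
  using assms
proof (induction rule: pres_cong.induct)
  case (refl u)
  then show ?case by (intro pres_cong.refl) auto
next
  case (step s t p' q')
  then have "((p @ p') @ s @ (q' @ q), (p @ p') @ t @ (q' @ q)) \<in> pres_cong X R"
    by (intro pres_cong.step) auto
  then show ?case by simp
next
  case (sym u v)
  then show ?case by (simp add: pres_cong.sym)
next
  case (trans u v w)
  then show ?case using pres_cong.trans by metis
qed

lemma pres_cong_append:
  assumes "(u, u') \<in> pres_cong X R" "(v, v') \<in> pres_cong X R"
  shows "(u @ v, u' @ v') \<in> pres_cong X R"
proof (rule pres_cong.trans)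
  show "(u @ v, u' @ v) \<in> pres_cong X R"
    using pres_cong_context[OF assms(1), of "[]" v] pres_cong_lists[OF assms(2)] by simp
  show "(u' @ v, u' @ v') \<in> pres_cong X R"
    using pres_cong_context[OF assms(2), of u' "[]"] pres_cong_lists[OF assms(1)] by simp
qed

lemma presented_monoid_mult:
  assumes "u \<in> lists X" "v \<in> lists X"
  shows "pres_cong X R `` {u} \<otimes>\<^bsub>presented_monoid X R\<^esub> pres_cong X R `` {v}
    = pres_cong X R `` {u @ v}"
proof -
  have "pres_cong X R `` {u' @ v'} = pres_cong X R `` {u @ v}"
    if "u' \<in> pres_cong X R `` {u}" "v' \<in> pres_cong X R `` {v}" for u' v'
  proof -
    have "(u @ v, u' @ v') \<in> pres_cong X R"
      using that by (intro pres_cong_append) simp_all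
    from equiv_class_eq[OF equiv_pres_cong this] show ?thesis by simp
  qed
  moreover have "u \<in> pres_cong X R `` {u}" "v \<in> pres_cong X R `` {v}"
    using assms by (simp_all add: pres_cong.refl)
  ultimately show ?thesis
    unfolding presented_monoid_def monoid.simps by blast
qed

lemma monoid_presented_monoid: "monoid (presented_monoid X R)"
proof -
  let ?M = "presented_monoid X R" and ?cls = "\<lambda>u. pres_cong X R `` {u}"
  have carrierI: "?cls u \<in> carrier ?M" if "u \<in> lists X" for u
    using that by (simp add: presented_monoid_def quotientI)
  have carrierE: thesis
    if "a \<in> carrier ?M" "\<And>u. u \<in> lists X \<Longrightarrow> a = ?cls u \<Longrightarrow> thesis" for a thesis
    using that by (auto simp: presented_monoid_def quotient_def)
  have one: "\<one>\<^bsub>?M\<^esub> = ?cls []"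
    by (simp add: presented_monoid_def)
  have app: "u @ v \<in> lists X" if "u \<in> lists X" "v \<in> lists X" for u v
    using that by simp
  have nil: "[] \<in> lists X" by simp
  show ?thesis
  proof (rule monoidI)
    fix a b assume "a \<in> carrier ?M" "b \<in> carrier ?M"
    then show "a \<otimes>\<^bsub>?M\<^esub> b \<in> carrier ?M"
      by (elim carrierE) (simp only: presented_monoid_mult carrierI app)
  next
    show "\<one>\<^bsub>?M\<^esub> \<in> carrier ?M"
      by (simp only: one carrierI nil)
  next
    fix a b c assume "a \<in> carrier ?M" "b \<in> carrier ?M" "c \<in> carrier ?M"
    then show "a \<otimes>\<^bsub>?M\<^esub> b \<otimes>\<^bsub>?M\<^esub> c = a \<otimes>\<^bsub>?M\<^esub> (b \<otimes>\<^bsub>?M\<^esub> c)"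
      by (elim carrierE) (simp only: presented_monoid_mult app append_assoc)
  next
    fix a assume "a \<in> carrier ?M"
    then show "\<one>\<^bsub>?M\<^esub> \<otimes>\<^bsub>?M\<^esub> a = a"
      by (elim carrierE) (simp only: one presented_monoid_mult nil append_Nil)
  next
    fix a assume "a \<in> carrier ?M"
    then show "a \<otimes>\<^bsub>?M\<^esub> \<one>\<^bsub>?M\<^esub> = a"
      by (elim carrierE) (simp only: one presented_monoid_mult nil append_Nil2)
  qed
qed

section \<open>The free regular star-monoid\<close>

text \<open>
  The alphabet consisting of \<open>A\<close> and its disjoint copy is the disjoint sum \<open>A <+> A\<close>:
  \<open>Inl a\<close> is the letter \<open>a\<close>, and \<open>Inr a\<close> is its starred copy.
\<close>

fun star_letter :: "'a + 'a \<Rightarrow> 'a + 'a" where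
  "star_letter (Inl a) = Inr a"
| "star_letter (Inr a) = Inl a"

definition star_word :: "('a + 'a) list \<Rightarrow> ('a + 'a) list" where
  "star_word w = rev (map star_letter w)"

definition free_regular_star_monoid :: "'a set \<Rightarrow> ('a + 'a) list set monoid" where
  "free_regular_star_monoid A =
    presented_monoid (A <+> A) {(w @ star_word w @ w, w) |w. w \<in> lists (A <+> A)}"

lemma star_word_append: "star_word (x @ y) = star_word y @ star_word x"
  by (simp add: star_word_def)

lemma star_letter_star_letter [simp]: "star_letter (star_letter x) = x"
  by (cases x) auto

lemma star_word_star_word [simp]: "star_word (star_word w) = w"
  by (simp add: star_word_def rev_map comp_def)

section \<open>Regular languages, rational and automatic monoids\<close>

text \<open>
  Recognition by a complete deterministic finite automaton with input alphabet \<open>S\<close>,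
  state set \<open>Q\<close>, initial state \<open>i\<close>, transition function \<open>d\<close> and accepting states \<open>F\<close>.
  Taking states in \<open>nat\<close> is no restriction, since every finite state set can be renumbered.
\<close>

definition regular_language :: "'s set \<Rightarrow> 's list set \<Rightarrow> bool" where
  "regular_language S L \<longleftrightarrow>
    (\<exists>(Q :: nat set) i d F.
      finite Q \<and> i \<in> Q \<and> F \<subseteq> Q \<and> (\<forall>q\<in>Q. \<forall>s\<in>S. d q s \<in> Q) \<and>
      L = {w \<in> lists S. foldl d i w \<in> F})"

definition word_value :: "('m, 'z) monoid_scheme \<Rightarrow> 'm list \<Rightarrow> 'm" where
  "word_value M w = foldr (\<lambda>x y. x \<otimes>\<^bsub>M\<^esub> y) w \<one>\<^bsub>M\<^esub>"

definition finite_generating_set :: "('m, 'z) monoid_scheme \<Rightarrow> 'm set \<Rightarrow> bool" where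
  "finite_generating_set M B \<longleftrightarrow>
    finite B \<and> B \<subseteq> carrier M \<and> carrier M = word_value M ` lists B"

definition rational_monoid :: "('m, 'z) monoid_scheme \<Rightarrow> bool" where
  "rational_monoid M \<longleftrightarrow>
    (\<exists>B L. finite_generating_set M B \<and> regular_language B L \<and>
      (\<forall>m\<in>carrier M. \<exists>!w. w \<in> L \<and> word_value M w = m))"

text \<open>
  \<open>padded_pair u v\<close> is the pair \<open>(u, v)\<close> read synchronously on two tapes, with \<open>None\<close> as the
  padding symbol at the right end of the shorter word. In the natural-number subtractions, at
  most one of the two paddings is nonempty.
\<close>

definition padded_pair :: "'s list \<Rightarrow> 's list \<Rightarrow> ('s option \<times> 's option) list" where
  "padded_pair u v =
    zip (map Some u @ replicate (length v - length u) None)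
        (map Some v @ replicate (length u - length v) None)"

definition synchronous_rational :: "'s set \<Rightarrow> ('s list \<times> 's list) set \<Rightarrow> bool" where
  "synchronous_rational S P \<longleftrightarrow>
    regular_language (insert None (Some ` S) \<times> insert None (Some ` S))
      {padded_pair u v |u v. (u, v) \<in> P}"

definition automatic_monoid :: "('m, 'z) monoid_scheme \<Rightarrow> bool" where
  "automatic_monoid M \<longleftrightarrow>
    (\<exists>B L. finite_generating_set M B \<and> regular_language B L \<and>
      (\<forall>m\<in>carrier M. \<exists>w\<in>L. word_value M w = m) \<and>
      (\<forall>x\<in>insert \<one>\<^bsub>M\<^esub> B.
        synchronous_rational B
          {(u, v). u \<in> L \<and> v \<in> L \<and> word_value M u \<otimes>\<^bsub>M\<^esub> x = word_value M v}))"

end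

theory Submission
  imports Defs "HOL-Library.Sublist"
begin

text \<open>
  Read a word as a walk on the integers that starts at \<open>0\<close>, where \<open>Inl a\<close> is a step up and \<open>Inr a\<close>
  a step down. In \<open>w w\<^sup>\<star> w\<close> the last two factors only revisit what the first factor has visited, so
  the order in which new integers are discovered depends only on the element represented. So does
  the end point, as \<open>w\<^sup>\<star>\<close> undoes the displacement of \<open>w\<close> (\<open>star_cong_invariants\<close>).
  Two consequences pull in opposite directions.

  \<^item> Over the two letters \<open>Inl a\<close>, \<open>Inr a\<close>, walks that stay in a fixed finite set represent only
    finitely many elements (\<open>finite_classes_bounded_range\<close>). A shortest representative is a zigzag
    whose run lengths have no interior local minimum, not even a weak one, because
    \<open>x\<^sup>k (x\<^sup>\<star>)\<^sup>m x\<^sup>n\<close> with \<open>m \<le> k\<close>,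
    \<open>m \<le> n\<close> equals \<open>x\<^bsup>k + n - m\<^esup>\<close>; such a zigzag in a bounded strip is short.

  \<^item> The spiral \<open>0, N, -N, 2 N, -2 N, \<dots>\<close> discovers its turning points in this order, hence every
    walk with the same value swings between them too (\<open>alternating_generator_prefixes\<close>), over
    whatever generators it is written.

  Take a language \<open>L\<close> of representatives that is recognized by finitely many states, and a spiral with
  more lower turning points than there are states and with very long swings.
  Two of its lower turning points are reached in the same state; the loop between them descends in total, but it contains a long
  ascent, in which pumping yields an ascending loop at the same state. A suitable combination of both
  is a nonempty loop of total height \<open>0\<close> (\<open>zero_height_loop\<close>). Pumping that loop gives infinitely many
  words of \<open>L\<close>, of different lengths, whose walks stay in one finite set, so two of them have the same
  value. This contradicts uniqueness of normal forms, and it needs only that words of \<open>L\<close> with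
  the same value have the same length (\<open>no_recognizable_length_section\<close>).

  The weaker requirement on \<open>L\<close> also settles the automatic case: the words of an automatic structure
  that are shortest among those with their value form a recognizable language, by a
  subset construction on the automaton for equality, and they satisfy it by construction. Recognition
  is expressed by a right-invariant map of finite range instead of an automaton, so that this
  subset construction needs no renumbering of states.

  For larger rank, the argument takes place in the submonoid generated by one letter and its star.
  It is closed under factors, because the relations preserve the set of letters that occur.
\<close>

abbreviation star_cong :: "'a set \<Rightarrow> (('a + 'a) list \<times> ('a + 'a) list) set" where
  "star_cong A \<equiv>
    pres_cong (A <+> A) {(w @ star_word w @ w, w) |w. w \<in> lists (A <+> A)}"

section \<open>Words as walks on the integers\<close>

fun slope :: "'a + 'a \<Rightarrow> int" where
  "slope (Inl a) = 1"
| "slope (Inr a) = - 1"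

definition height :: "('a + 'a) list \<Rightarrow> int" where
  "height w = sum_list (map slope w)"

fun visited :: "int \<Rightarrow> ('a + 'a) list \<Rightarrow> int set" where
  "visited h [] = {h}"
| "visited h (x # w) = insert h (visited (h + slope x) w)"

text \<open>
  The sets that have been discovered at the successive moments of a walk from \<open>h\<close>, if \<open>S\<close> has been
  discovered before. This chain of sets records the order of discovery.
\<close>

fun explored :: "int set \<Rightarrow> int \<Rightarrow> ('a + 'a) list \<Rightarrow> int set set" where
  "explored S h [] = {S}"
| "explored S h (x # w) =
    insert S (explored (insert (h + slope x) S) (h + slope x) w)"

lemma slope_star_letter [simp]: "slope (star_letter x) = - slope x"
  by (cases x) auto

lemma abs_slope [simp]: "\<bar>slope x\<bar> = 1"
  by (cases x) auto

lemma height_simps [simp]: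
  "height [] = 0"
  "height (x # w) = slope x + height w"
  "height (u @ v) = height u + height v"
  "height (replicate n x) = int n * slope x"
  by (simp_all add: height_def sum_list_replicate)

lemma height_star_word [simp]: "height (star_word w) = - height w"
  by (induction w) (simp_all add: star_word_def)

lemma abs_height_le: "\<bar>height w\<bar> \<le> int (length w)"
proof (induction w)
  case (Cons x w)
  have "\<bar>slope x + height w\<bar> \<le> \<bar>slope x\<bar> + \<bar>height w\<bar>"
    by (rule abs_triangle_ineq)
  with Cons show ?case by simp
qed simp

lemma visited_start [simp]: "h \<in> visited h w"
  by (cases w) auto

lemma finite_visited [simp]: "finite (visited h w)"
  by (induction w arbitrary: h) auto

lemma explored_start [simp]: "S \<in> explored S h w"
  by (cases w) auto

lemma visited_append:
  "visited h (u @ v) = visited h u \<union> visited (h + height u) v"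
proof (induction u arbitrary: h)
  case Nil
  then show ?case using visited_start[of h v] by auto
qed (auto simp: add.assoc)

lemma visited_iff_prefix:
  "k \<in> visited h w \<longleftrightarrow> (\<exists>p. prefix p w \<and> k = h + height p)"
proof (induction w arbitrary: h)
  case (Cons x w)
  show ?case
    by (auto simp: Cons prefix_Cons intro: exI[of _ "[]"] exI[of _ "x # p" for p])
qed simp

text \<open>
  The starred word walks the same path backwards.
\<close>

lemma visited_star_word:
  "visited (h + height w) (star_word w) = visited h w"
proof (induction w arbitrary: h)
  case (Cons x w)
  have "star_word (x # w) = star_word w @ [star_letter x]"
    by (simp add: star_word_def)
  then show ?case
    using Cons[of "h + slope x"] visited_start[of "h + slope x" w]
    by (auto simp: visited_append add.assoc)
qed (simp add: star_word_def)

lemma explored_append: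
  assumes "h \<in> S"
  shows "explored S h (u @ v) =
    explored S h u \<union> explored (S \<union> visited h u) (h + height u) v"
  using assms
proof (induction u arbitrary: S h)
  case (Cons x u)
  have "insert (h + slope x) S \<union> visited (h + slope x) u = S \<union> visited h (x # u)"
    using Cons.prems visited_start[of "h + slope x" u] by auto
  then show ?case
    using Cons.IH[of "h + slope x" "insert (h + slope x) S"] by (simp add: add.assoc)
qed (auto simp: insert_absorb)

lemma explored_revisit:
  "visited h u \<subseteq> S \<Longrightarrow> explored S h u = {S}"
proof (induction u arbitrary: h)
  case (Cons x u)
  then have "h + slope x \<in> S" using visited_start[of "h + slope x" u] by auto
  with Cons show ?case by (simp add: insert_absorb)
qed simp

lemma explored_total: "h \<in> S \<Longrightarrow> S \<union> visited h u \<in> explored S h u"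
proof (induction u arbitrary: S h)
  case (Cons x u)
  have "insert (h + slope x) S \<union> visited (h + slope x) u = S \<union> visited h (x # u)"
    using Cons.prems visited_start[of "h + slope x" u] by auto
  then show ?case
    using Cons.IH[of "h + slope x" "insert (h + slope x) S"] by simp
qed (simp add: insert_absorb)

text \<open>
  After the first \<open>w\<close>, the factors \<open>w\<^sup>\<star>\<close> and \<open>w\<close> run through known territory only.
\<close>

lemma explored_relation:
  assumes "h \<in> S"
  shows "explored S h (w @ star_word w @ w @ q) = explored S h (w @ q)"
proof -
  define S' where "S' = S \<union> visited h w"
  have h: "h \<in> S'" "h + height w \<in> S'"
    using assms visited_star_word[of h w] visited_start[of "h + height w" "star_word w"]
    by (auto simp: S'_def)
  have sub: "visited h w \<subseteq> S'" by (simp add: S'_def)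
  have "explored S h (w @ star_word w @ w @ q) =
      explored S h w \<union> ({S'} \<union> ({S'} \<union> explored S' (h + height w) q))"
    using assms h sub
    by (simp add: explored_append explored_revisit visited_star_word
        Un_absorb2 flip: S'_def)
  also have "\<dots> = explored S h w \<union> explored S' (h + height w) q"
    using explored_total[OF assms, of w] by (auto simp: S'_def)
  also have "\<dots> = explored S h (w @ q)"
    using assms by (simp add: explored_append S'_def)
  finally show ?thesis .
qed

text \<open>
  The generators that occur in a word, with or without a star.
\<close>

definition content :: "('a + 'a) list \<Rightarrow> 'a set" where
  "content w = case_sum id id ` set w"

lemma content_append [simp]: "content (u @ v) = content u \<union> content v"
  by (simp add: content_def image_Un)

lemma content_star_word [simp]: "content (star_word w) = content w"
proof -
  have "case_sum id id (star_letter x) = (case_sum id id x :: 'a)" for x :: "'a + 'a"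
    by (cases x) auto
  then show ?thesis
    by (simp add: content_def star_word_def image_image)
qed

lemma content_subset_singleton:
  "content w \<subseteq> {a} \<longleftrightarrow> w \<in> lists {Inl a, Inr a}"
  by (induction w) (auto simp: content_def split: sum.splits)

lemma star_cong_invariants:
  assumes "(u, v) \<in> star_cong A"
  shows "content u = content v \<and> height u = height v \<and> visited h u = visited h v \<and>
    (\<forall>S. h \<in> S \<longrightarrow> explored S h u = explored S h v)"
  using assms
proof (induction rule: pres_cong.induct)
  case (step s t p q)
  then obtain w where st: "s = w @ star_word w @ w" "t = w" by auto
  have "explored S h (p @ s @ q) = explored S h (p @ t @ q)" if "h \<in> S" for S
  proof -
    have "h + height p \<in> S \<union> visited h p"
      by (auto simp: visited_iff_prefix)
    with that show ?thesis
      by (simp add: st explored_append[of h S p] explored_relation)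
  qed
  moreover have "visited (h + height p) (w @ star_word w @ w @ q) = visited (h + height p) (w @ q)"
    by (auto simp: visited_append visited_star_word)
  ultimately show ?case
    by (auto simp: st visited_append)
qed auto

section \<open>Walks in a bounded strip\<close>

text \<open>
  A word over one letter and its star, given by its first letter and its run lengths.
\<close>

fun zigzag :: "'a + 'a \<Rightarrow> nat list \<Rightarrow> ('a + 'a) list" where
  "zigzag x [] = []"
| "zigzag x (n # ns) = replicate n x @ zigzag (star_letter x) ns"

definition valley_free :: "nat list \<Rightarrow> bool" where
  "valley_free ns \<longleftrightarrow>
    (\<forall>pre k m n post. ns = pre @ [k, m, n] @ post \<longrightarrow> k < m \<or> n < m)"

lemma valley_free_ConsD: "valley_free (k # ns) \<Longrightarrow> valley_free ns"
  unfolding valley_free_def by (metis append_Cons)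

lemma valley_free_head: "valley_free (k # m # n # ns) \<Longrightarrow> k < m \<or> n < m"
  unfolding valley_free_def by (metis append_Nil append_Cons)

text \<open>
  Once a list without valleys fails to increase, it decreases strictly from then on.
\<close>

lemma length_valley_free_descending:
  "valley_free (k # m # ns) \<Longrightarrow> m \<le> k \<Longrightarrow> length ns \<le> m"
proof (induction ns arbitrary: k m)
  case (Cons n ns)
  then have "n < m" using valley_free_head by fastforce
  moreover have "length ns \<le> n"
    using Cons.IH[of m n] Cons.prems \<open>n < m\<close> valley_free_ConsD by fastforce
  ultimately show ?case by simp
qed simp

text \<open>
  A strict increase up to at most \<open>M\<close> is followed by a strict decrease. The summand \<open>k\<close>
  accounts for the values below the first entry, which the increasing part cannot use.
\<close>

lemma length_valley_free_le:
  assumes "valley_free (k # ns)" "\<forall>n\<in>set (k # ns). n \<le> M"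
  shows "length (k # ns) + k \<le> 2 * M + 2"
  using assms
proof (induction ns arbitrary: k)
  case (Cons m ns)
  show ?case
  proof (cases "m \<le> k")
    case True
    then show ?thesis using length_valley_free_descending[OF Cons.prems(1)] Cons.prems(2) by simp
  next
    case False
    then show ?thesis using Cons.IH[of m] Cons.prems valley_free_ConsD by fastforce
  qed
qed simp

text \<open>
  The letter \<open>y\<close> with which the second part starts is \<open>x\<close> or its star according to the parity of the
  length of \<open>ms\<close>.
\<close>

lemma zigzag_append:
  "\<exists>y\<in>{x, star_letter x}. \<forall>ns. zigzag x (ms @ ns) = zigzag x ms @ zigzag y ns"
proof (induction ms arbitrary: x)
  case (Cons m ms)
  from Cons[of "star_letter x"] show ?case by auto
qed auto

lemma zigzag_exists:
  assumes "w \<in> lists {x, star_letter x}" "w \<noteq> []"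
  shows "\<exists>n ns. w = zigzag (hd w) (n # ns) \<and> (\<forall>k\<in>set (n # ns). k > 0)"
  using assms
proof (induction w rule: induct_list012)
  case (2 y)
  have "[y] = zigzag (hd [y]) (1 # [])" by simp
  then show ?case by fastforce
next
  case (3 y z v)
  then have "z # v \<in> lists {x, star_letter x}" by simp
  with 3 obtain n ns where IH: "z # v = zigzag z (n # ns)" "\<forall>k\<in>set (n # ns). k > 0"
    by fastforce
  have yz: "y \<in> {x, star_letter x}" "z \<in> {x, star_letter x}"
    using "3.prems"(1) by simp_all
  show ?case
  proof (cases "z = y")
    case True
    then have "y # z # v = zigzag y (Suc n # ns)" using IH(1) by simp
    moreover have "\<forall>k\<in>set (Suc n # ns). k > 0" using IH(2) by simp
    ultimately show ?thesis unfolding list.sel(1) by blast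
  next
    case False
    then have "z = star_letter y" using yz by auto
    then have "y # z # v = zigzag y (1 # n # ns)" using IH(1) by simp
    moreover have "\<forall>k\<in>set (1 # n # ns). k > 0" using IH(2) by simp
    ultimately show ?thesis unfolding list.sel(1) by blast
  qed
qed simp

lemma length_zigzag: "length (zigzag x ns) = sum_list ns"
  by (induction ns arbitrary: x) auto

text \<open>
  A run of length \<open>n\<close> visits \<open>n + 1\<close> different integers.
\<close>

lemma run_less_card_visited:
  "n \<in> set ns \<Longrightarrow> n < card (visited h (zigzag x ns))"
proof (induction ns arbitrary: h x)
  case (Cons m ns)
  show ?case
  proof (cases "n = m")
    case True
    have "inj_on (\<lambda>i. h + int i * slope x) {..n}"
      by (cases x) (auto simp: inj_on_def)
    then have "n < card ((\<lambda>i. h + int i * slope x) ` {..n})"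
      by (simp add: card_image)
    also have "\<dots> \<le> card (visited h (zigzag x (m # ns)))"
    proof (rule card_mono)
      show "(\<lambda>i. h + int i * slope x) ` {..n} \<subseteq> visited h (zigzag x (m # ns))"
      proof (clarsimp simp: True)
        fix i assume "i \<le> m"
        then have "prefix (replicate i x) (replicate m x @ zigzag (star_letter x) ns)"
          by (metis append_assoc le_add_diff_inverse prefixI replicate_add)
        then show "h + int i * slope x \<in> visited h (replicate m x @ zigzag (star_letter x) ns)"
          unfolding visited_iff_prefix by (metis height_simps(4))
      qed
    qed simp
    finally show ?thesis .
  next
    case False
    then have "n < card (visited (h + int m * slope x) (zigzag (star_letter x) ns))"
      using Cons by simp
    also have "\<dots> \<le> card (visited h (zigzag x (m # ns)))"
      by (rule card_mono) (auto simp: visited_append)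
    finally show ?thesis .
  qed
qed simp

text \<open>
  The middle run together with \<open>m\<close> letters on either side of it has the form \<open>w w\<^sup>\<star> w\<close>.
\<close>

lemma valley_shortening:
  assumes "x \<in> A <+> A" "m \<le> k" "m \<le> n" "p \<in> lists (A <+> A)" "q \<in> lists (A <+> A)"
  shows "(p @ (replicate k x @ replicate m (star_letter x) @ replicate n x) @ q,
          p @ replicate (k + n - m) x @ q) \<in> star_cong A"
proof -
  let ?w = "replicate m x"
  have lists: "replicate i x \<in> lists (A <+> A)" for i
    using assms(1) by auto
  have sx: "star_letter x \<in> A <+> A"
    using assms(1) by auto
  have star: "star_word ?w = replicate m (star_letter x)"
    by (simp add: star_word_def)
  have "((p @ replicate (k - m) x) @ (?w @ star_word ?w @ ?w) @ (replicate (n - m) x @ q),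
         (p @ replicate (k - m) x) @ ?w @ (replicate (n - m) x @ q)) \<in> star_cong A"
    using assms lists sx by (intro pres_cong.step) (auto simp: star)
  moreover have "replicate k x = replicate (k - m) x @ ?w" "replicate n x = ?w @ replicate (n - m) x"
    "replicate (k + n - m) x = replicate (k - m) x @ ?w @ replicate (n - m) x"
    using assms by (simp_all flip: replicate_add)
  ultimately show ?thesis
    by (simp only: star append_assoc)
qed

text \<open>
  A shortest representative has no valley among its run lengths, for \<open>valley_shortening\<close> would give a
  shorter one. It still uses one letter only and visits the same set, so there are few runs and
  each of them is short.
\<close>

lemma bounded_representative:
  assumes "w \<in> lists {Inl a, Inr a}" "a \<in> A" "card (visited 0 w) \<le> M"
  shows "\<exists>v\<in>lists {Inl a, Inr a}. (w, v) \<in> star_cong A \<and> length v \<le> (2 * M + 2) * M"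
proof -
  have w: "w \<in> lists (A <+> A)" using assms(1,2) by auto
  then have "(w, w) \<in> star_cong A" by (rule pres_cong.refl)
  then obtain v where v: "(w, v) \<in> star_cong A"
    and min: "\<And>u. (w, u) \<in> star_cong A \<Longrightarrow> length v \<le> length u"
    using ex_has_least_nat[of "\<lambda>u. (w, u) \<in> star_cong A" w length] by blast
  have vX: "v \<in> lists {Inl a, Inr a}"
    using assms(1) star_cong_invariants[OF v] by (simp flip: content_subset_singleton)
  have card: "card (visited 0 v) \<le> M"
    using assms(3) star_cong_invariants[OF v, of 0] by simp
  have "length v \<le> (2 * M + 2) * M"
  proof (cases "v = []")
    case False
    have "v \<in> lists {Inl a, star_letter (Inl a)}" using vX by simp
    from zigzag_exists[OF this False] obtain n ns where
      z: "v = zigzag (hd v) (n # ns)" and pos: "\<forall>k\<in>set (n # ns). k > 0" by blast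
    have le: "\<forall>k\<in>set (n # ns). k \<le> M"
      using run_less_card_visited[of _ "n # ns" 0 "hd v"] z card by fastforce
    have hd: "hd v \<in> {Inl a, Inr a}"
      using False vX by (metis in_lists_conv_set list.set_sel(1))
    have "valley_free (n # ns)"
      unfolding valley_free_def
    proof (intro allI impI, rule ccontr)
      fix pre k m l post
      assume ns: "n # ns = pre @ [k, m, l] @ post" and "\<not> (k < m \<or> l < m)"
      then have kml: "m \<le> k" "m \<le> l" by auto
      obtain y where y: "y \<in> {hd v, star_letter (hd v)}"
        and app: "\<And>ns. zigzag (hd v) (pre @ ns) = zigzag (hd v) pre @ zigzag y ns"
        using zigzag_append[of "hd v" pre] by blast
      define p where "p = zigzag (hd v) pre"
      define q where "q = zigzag (star_letter y) post"
      have v_eq: "v = p @ (replicate k y @ replicate m (star_letter y) @ replicate l y) @ q"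
        using z ns app by (simp add: p_def q_def)
      have yX: "y \<in> A <+> A" using y hd assms(2) by auto
      have "v \<in> lists (A <+> A)" using vX assms(2) by auto
      then have "p \<in> lists (A <+> A)" "q \<in> lists (A <+> A)" by (auto simp: v_eq)
      from valley_shortening[OF yX kml this]
      have "(v, p @ replicate (k + l - m) y @ q) \<in> star_cong A" by (simp add: v_eq)
      with v have "length v \<le> length (p @ replicate (k + l - m) y @ q)"
        by (intro min) (rule pres_cong.trans)
      moreover have "m > 0" using pos by (simp add: ns)
      ultimately show False using kml by (simp add: v_eq)
    qed
    from length_valley_free_le[OF this le] have len: "length (n # ns) \<le> 2 * M + 2" by simp
    have "length v = sum_list (n # ns)"
      using z length_zigzag by metis
    also have "\<dots> \<le> length (n # ns) * M"
      using sum_list_mono[of "n # ns" "\<lambda>k. k" "\<lambda>_. M"] le by (simp add: sum_list_triv)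
    also have "\<dots> \<le> (2 * M + 2) * M" using len by (rule mult_right_mono) simp
    finally show ?thesis .
  qed simp
  with v vX show ?thesis by blast
qed

lemma finite_classes_bounded_range:
  assumes "a \<in> A" "finite S"
  shows "finite ((\<lambda>w. star_cong A `` {w}) ` {w \<in> lists {Inl a, Inr a}. visited 0 w \<subseteq> S})"
proof (rule finite_subset)
  let ?K = "(2 * card S + 2) * card S"
  let ?V = "{v. set v \<subseteq> {Inl a, Inr a} \<and> length v \<le> ?K}"
  show "finite ((\<lambda>w. star_cong A `` {w}) ` ?V)"
    by (intro finite_imageI finite_lists_length_le) simp
  show "(\<lambda>w. star_cong A `` {w}) ` {w \<in> lists {Inl a, Inr a}. visited 0 w \<subseteq> S}
      \<subseteq> (\<lambda>w. star_cong A `` {w}) ` ?V"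
  proof
    fix C assume "C \<in> (\<lambda>w. star_cong A `` {w}) ` {w \<in> lists {Inl a, Inr a}. visited 0 w \<subseteq> S}"
    then obtain w where w: "C = star_cong A `` {w}" "w \<in> lists {Inl a, Inr a}"
      "card (visited 0 w) \<le> card S"
      using assms(2) card_mono by fastforce
    from bounded_representative[OF w(2) assms(1) w(3)] obtain v where
      v: "v \<in> lists {Inl a, Inr a}" "(w, v) \<in> star_cong A" "length v \<le> ?K" by blast
    have "C = star_cong A `` {v}"
      unfolding w(1) by (rule equiv_class_eq[OF equiv_pres_cong v(2)])
    then show "C \<in> (\<lambda>w. star_cong A `` {w}) ` ?V" using v by blast
  qed
qed

section \<open>Spirals\<close>

text \<open>
  The walk \<open>0, N, -N, 2 N, -2 N, \<dots>, i N, -i N\<close>.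
\<close>

fun spiral :: "'a \<Rightarrow> nat \<Rightarrow> nat \<Rightarrow> ('a + 'a) list" where
  "spiral a N 0 = []"
| "spiral a N (Suc i) = spiral a N i
    @ replicate ((2 * i + 1) * N) (Inl a) @ replicate ((2 * i + 2) * N) (Inr a)"

text \<open>
  If all sets in the chain of discovered sets have this property, then the turning points of the
  spiral can only be discovered in the order in which the spiral reaches them.
\<close>

definition alternating :: "nat \<Rightarrow> int set \<Rightarrow> bool" where
  "alternating N S \<longleftrightarrow> (\<forall>i.
    (int (Suc i * N) \<in> S \<longrightarrow> - int (i * N) \<in> S) \<and>
    (- int (Suc i * N) \<in> S \<longrightarrow> int (Suc i * N) \<in> S))"

lemma height_spiral: "height (spiral a N i) = - int (i * N)"
  by (induction i) (auto simp: algebra_simps)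

lemma spiral_in_lists: "spiral a N i \<in> lists {Inl a, Inr a}"
  by (induction i) auto

lemma visited_ascent: "visited h (replicate n (Inl a)) = {h..h + int n}"
  by (induction n arbitrary: h) auto

lemma visited_descent: "visited h (replicate n (Inr a)) = {h - int n..h}"
  by (induction n arbitrary: h) auto

lemma explored_ascent:
  assumes "T \<in> explored {l..u} h (replicate n (Inl a))" "l \<le> h" "h \<le> u"
  shows "\<exists>u'. T = {l..u'} \<and> u \<le> u' \<and> u' \<le> max u (h + int n)"
  using assms
proof (induction n arbitrary: u h)
  case (Suc n)
  have "insert (h + 1) {l..u} = {l..max u (h + 1)}"
    using Suc.prems(2,3) by auto
  with Suc.prems(1) have "T = {l..u} \<or> T \<in> explored {l..max u (h + 1)} (h + 1) (replicate n (Inl a))"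
    by simp
  then show ?case
  proof
    assume "T \<in> explored {l..max u (h + 1)} (h + 1) (replicate n (Inl a))"
    from Suc.IH[OF this] Suc.prems show ?case by fastforce
  qed auto
qed auto

lemma explored_descent:
  assumes "T \<in> explored {l..u} h (replicate n (Inr a))" "l \<le> h" "h \<le> u"
  shows "\<exists>l'. T = {l'..u} \<and> l' \<le> l \<and> min l (h - int n) \<le> l'"
  using assms
proof (induction n arbitrary: l h)
  case (Suc n)
  have "insert (h - 1) {l..u} = {min l (h - 1)..u}"
    using Suc.prems(2,3) by auto
  with Suc.prems(1) have "T = {l..u} \<or> T \<in> explored {min l (h - 1)..u} (h - 1) (replicate n (Inr a))"
    by simp
  then show ?case
  proof
    assume "T \<in> explored {min l (h - 1)..u} (h - 1) (replicate n (Inr a))"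
    from Suc.IH[OF this] Suc.prems show ?case by fastforce
  qed auto
qed auto

lemma visited_spiral: "visited 0 (spiral a N i) = {- int (i * N)..int (i * N)}"
proof (induction i)
  case (Suc i)
  have "int (i * N) \<le> int (Suc i * N)" by simp
  then show ?case
    by (auto simp: visited_append visited_ascent visited_descent height_spiral Suc
        algebra_simps)
qed simp

text \<open>
  The intervals between \<open>{- i N..i N}\<close> and \<open>{- (i + 1) N..(i + 1) N}\<close> that arise when the upper end
  is extended first.
\<close>

lemma alternating_interval:
  assumes "N > 0" "int (i * N) \<le> u" "u \<le> int (Suc i * N)"
    "l \<le> - int (i * N)" "- int (Suc i * N) \<le> l"
    "l = - int (i * N) \<or> u = int (Suc i * N)"
  shows "alternating N {l..u}"
  unfolding alternating_def
proof (intro allI conjI impI)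
  fix j
  assume "int (Suc j * N) \<in> {l..u}"
  with assms(3) have "Suc j * N \<le> Suc i * N" by (simp only: atLeastAtMost_iff) linarith
  with assms(1) have "j * N \<le> i * N" by simp
  then have "int (j * N) \<le> int (i * N)" by (rule of_nat_mono)
  with assms(2,4) show "- int (j * N) \<in> {l..u}" unfolding atLeastAtMost_iff by linarith
next
  fix j
  assume *: "- int (Suc j * N) \<in> {l..u}"
  show "int (Suc j * N) \<in> {l..u}"
    using assms(6)
  proof
    assume "l = - int (i * N)"
    with * assms(2,4) show ?thesis unfolding atLeastAtMost_iff by linarith
  next
    assume "u = int (Suc i * N)"
    with * assms(5) assms(2,4) show ?thesis unfolding atLeastAtMost_iff by linarith
  qed
qed

lemma alternating_spiral:
  assumes "N > 0"
  shows "S \<in> explored {0} 0 (spiral a N k) \<Longrightarrow> alternating N S"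
proof (induction k)
  case 0
  then show ?case using assms alternating_interval[of N 0 0 0] by simp
next
  case (Suc i)
  let ?up = "replicate ((2 * i + 1) * N) (Inl a)"
  let ?down = "replicate ((2 * i + 2) * N) (Inr a)"
  let ?l = "- int (i * N)" and ?u = "int (i * N)" and ?u' = "int (Suc i * N)"
  have after_up: "?l + int ((2 * i + 1) * N) = ?u'" and after_down: "?u' - int ((2 * i + 2) * N) = - ?u'"
    by (simp_all add: algebra_simps)
  have uu': "?u \<le> ?u'" by simp
  have start: "{0} \<union> visited 0 (spiral a N i) = {?l..?u}"
    by (auto simp: visited_spiral)
  have mid: "{?l..?u} \<union> visited ?l ?up = {?l..?u'}"
    unfolding visited_ascent after_up using uu' by auto
  have "explored {0} 0 (spiral a N (Suc i)) = explored {0} 0 (spiral a N i) \<union>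
      (explored {?l..?u} ?l ?up \<union> explored {?l..?u'} ?u' ?down)"
    unfolding spiral.simps
    by (subst explored_append, simp, unfold start height_spiral, subst explored_append, simp)
      (use after_up in \<open>simp only: mid height_simps add_0 slope.simps mult_1_right\<close>)
  with Suc.prems consider "S \<in> explored {0} 0 (spiral a N i)"
    | "S \<in> explored {?l..?u} ?l ?up" | "S \<in> explored {?l..?u'} ?u' ?down" by blast
  then show ?case
  proof cases
    case 1
    then show ?thesis by (rule Suc.IH)
  next
    case 2
    from explored_ascent[OF this] obtain u where "S = {?l..u}" "?u \<le> u" "u \<le> ?u'"
      unfolding after_up using uu' by auto
    then show ?thesis using alternating_interval[OF assms, of i u ?l] by simp
  next
    case 3
    from explored_descent[OF this] obtain l where "S = {l..?u'}" "l \<le> ?l" "- ?u' \<le> l"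
      unfolding after_down using uu' by auto
    then show ?thesis using alternating_interval[OF assms, of i ?u' l] uu' by simp
  qed
qed

lemma alternating_visits:
  assumes "\<forall>S\<in>explored {0} 0 w. alternating N S" "prefix p w"
  shows "height p = int (Suc i * N) \<Longrightarrow> \<exists>p'. prefix p' p \<and> height p' = - int (i * N)"
    and "height p = - int (Suc i * N) \<Longrightarrow> \<exists>p'. prefix p' p \<and> height p' = int (Suc i * N)"
proof -
  obtain q where "w = p @ q" using assms(2) by (auto simp: prefix_def)
  then have "{0} \<union> visited 0 p \<in> explored {0} 0 w"
    using explored_total[of 0 "{0}" p] by (simp add: explored_append)
  moreover have "{0} \<union> visited 0 p = visited 0 p"
    using visited_start by auto
  ultimately have alt: "alternating N (visited 0 p)"
    using assms(1) by simp
  have "height p \<in> visited 0 p" by (auto simp: visited_iff_prefix)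
  with alt show
    "height p = int (Suc i * N) \<Longrightarrow> \<exists>p'. prefix p' p \<and> height p' = - int (i * N)"
    "height p = - int (Suc i * N) \<Longrightarrow> \<exists>p'. prefix p' p \<and> height p' = int (Suc i * N)"
    unfolding alternating_def visited_iff_prefix by (metis add_0)+
qed

text \<open>
  Each generator is spelled with at most \<open>C\<close> letters, so a position in the spelled word is at most
  \<open>C\<close> letters away from a boundary between generators. The trailing \<open>s\<close> lets the lemma be applied
  again to the prefix that it returns.
\<close>

lemma prefix_near_generator_prefix:
  assumes "prefix p (concat (map \<rho> ws) @ s)" "\<forall>b\<in>set ws. length (\<rho> b) \<le> C" "length s \<le> C"
  shows "\<exists>v s'. prefix v ws \<and> p = concat (map \<rho> v) @ s' \<and> length s' \<le> C"
  using assms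
proof (induction ws arbitrary: s rule: rev_induct)
  case Nil
  then have "length p \<le> C" using prefix_length_le by fastforce
  then show ?case by simp
next
  case (snoc b ws)
  from snoc.prems(1) consider "prefix p (concat (map \<rho> ws) @ \<rho> b)"
    | s' where "p = concat (map \<rho> (ws @ [b])) @ s'" "prefix s' s"
    by (force simp: prefix_append)
  then show ?case
  proof cases
    case 1
    from snoc.IH[OF this] snoc.prems(2) show ?thesis
      by (auto intro: prefix_order.trans)
  next
    case 2
    then show ?thesis using snoc.prems(3) prefix_length_le[OF 2(2)] by fastforce
  qed
qed

text \<open>
  Going backwards from a visit of \<open>- k N\<close>: before it \<open>k N\<close> was visited, before that
  \<open>- (k - 1) N\<close>, and so on. Each such visit is moved to the boundary of a generator: \<open>V i\<close> lies
  near the lower turning point \<open>- i N\<close>, and \<open>U i\<close> near the upper turning point \<open>(i + 1) N\<close>.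
\<close>

lemma alternating_generator_prefixes:
  assumes alt: "\<forall>S\<in>explored {0} 0 w. alternating N S"
    and "prefix (concat (map \<rho> v) @ s) w" "height (concat (map \<rho> v) @ s) = - int (k * N)"
    and "\<forall>b\<in>set v. length (\<rho> b) \<le> C" "length s \<le> C"
  shows "\<exists>V U. V k = v
    \<and> (\<forall>i\<le>k. \<bar>height (concat (map \<rho> (V i))) + int (i * N)\<bar> \<le> int C)
    \<and> (\<forall>i<k. prefix (V i) (U i) \<and> prefix (U i) (V (Suc i))
        \<and> \<bar>height (concat (map \<rho> (U i))) - int (Suc i * N)\<bar> \<le> int C)"
  using assms(2-)
proof (induction k arbitrary: v s)
  case 0
  then show ?case using abs_height_le[of s] by (intro exI[of _ "\<lambda>_. v"]) auto
next
  case (Suc k)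
  let ?h = "\<lambda>v. height (concat (map \<rho> v))"
  obtain p where p: "prefix p (concat (map \<rho> v) @ s)" "height p = int (Suc k * N)"
    using alternating_visits(2)[OF alt Suc.prems(1,2)] by blast
  from prefix_near_generator_prefix[OF p(1) Suc.prems(3,4)] obtain u s1 where
    u: "prefix u v" "p = concat (map \<rho> u) @ s1" "length s1 \<le> C" by blast
  have pw: "prefix p w" using p(1) Suc.prems(1) by (rule prefix_order.trans)
  obtain p' where p': "prefix p' p" "height p' = - int (k * N)"
    using alternating_visits(1)[OF alt pw p(2)] by blast
  have uC: "\<forall>b\<in>set u. length (\<rho> b) \<le> C"
    using u(1) Suc.prems(3) set_mono_prefix by blast
  from prefix_near_generator_prefix[OF p'(1)[unfolded u(2)] uC u(3)] obtain v' s2 where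
    v': "prefix v' u" "p' = concat (map \<rho> v') @ s2" "length s2 \<le> C" by blast
  have p'w: "prefix p' w" using p'(1) pw by (rule prefix_order.trans)
  have "\<forall>b\<in>set v'. length (\<rho> b) \<le> C"
    using v'(1) uC set_mono_prefix by blast
  from Suc.IH[OF p'w[unfolded v'(2)] p'(2)[unfolded v'(2)] this v'(3)] obtain V U where
    VU: "V k = v'" "\<forall>i\<le>k. \<bar>?h (V i) + int (i * N)\<bar> \<le> int C"
    "\<forall>i<k. prefix (V i) (U i) \<and> prefix (U i) (V (Suc i)) \<and> \<bar>?h (U i) - int (Suc i * N)\<bar> \<le> int C"
    by blast
  have hu: "\<bar>?h u - int (Suc k * N)\<bar> \<le> int C"
    using p(2)[unfolded u(2) height_simps] u(3) abs_height_le[of s1] by linarith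
  have hv: "\<bar>?h v + int (Suc k * N)\<bar> \<le> int C"
    using Suc.prems(2)[unfolded height_simps] Suc.prems(4) abs_height_le[of s] by linarith
  show ?case
  proof (rule exI[of _ "V(Suc k := v)"], rule exI[of _ "U(k := u)"], intro conjI allI impI)
    show "(V(Suc k := v)) (Suc k) = v" by simp
    show "\<bar>?h ((V(Suc k := v)) i) + int (i * N)\<bar> \<le> int C" if "i \<le> Suc k" for i
      using that VU(2) hv by (cases "i = Suc k") (simp_all del: of_nat_mult)
    fix i assume "i < Suc k"
    then have "i < k \<or> i = k" by auto
    then show "prefix ((V(Suc k := v)) i) ((U(k := u)) i)"
      "prefix ((U(k := u)) i) ((V(Suc k := v)) (Suc i))"
      "\<bar>?h ((U(k := u)) i) - int (Suc i * N)\<bar> \<le> int C"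
      using VU v'(1) u(1) hu by (auto simp del: of_nat_mult of_nat_Suc mult_Suc)
  qed
qed

section \<open>Pumping for right-invariant maps of finite range\<close>

text \<open>
  The map \<open>f\<close> stands for the state that a deterministic automaton reaches.
\<close>

definition right_invariant :: "'b set \<Rightarrow> ('b list \<Rightarrow> 'q) \<Rightarrow> bool" where
  "right_invariant D f \<longleftrightarrow>
    (\<forall>u\<in>lists D. \<forall>v\<in>lists D. \<forall>b\<in>D. f u = f v \<longrightarrow> f (u @ [b]) = f (v @ [b]))"

lemma right_invariant_append:
  assumes "right_invariant D f" "u \<in> lists D" "v \<in> lists D" "f u = f v" "w \<in> lists D"
  shows "f (u @ w) = f (v @ w)"
  using assms(5)
proof (induction w rule: rev_induct)
  case (snoc b w)
  then have "u @ w \<in> lists D" "v @ w \<in> lists D" "b \<in> D" "f (u @ w) = f (v @ w)"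
    using assms by auto
  then show ?case
    using assms(1) unfolding right_invariant_def by (metis append_assoc)
qed (simp add: assms)

lemma concat_replicate_in_lists: "c \<in> lists D \<Longrightarrow> concat (replicate n c) \<in> lists D"
  by (induction n) auto

lemma right_invariant_loop:
  assumes "right_invariant D f" "x \<in> lists D" "c \<in> lists D" "f (x @ c) = f x"
  shows "f (x @ concat (replicate n c)) = f x"
proof (induction n)
  case (Suc n)
  have "f ((x @ c) @ concat (replicate n c)) = f (x @ concat (replicate n c))"
    using assms concat_replicate_in_lists[OF assms(3)] by (intro right_invariant_append[OF assms(1)]) auto
  then show ?case using Suc by simp
qed simp

text \<open>
  A path that gains more weight than a repetition-free path can gain contains a loop of
  positive weight, possibly after the removal of loops of nonpositive weight; repeating that loop
  raises the weight beyond any bound without changing the state that is reached.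
\<close>

lemma raise_weight:
  fixes g :: "'b \<Rightarrow> int"
  assumes inv: "right_invariant D f" and fin: "finite (f ` lists D)"
    and g: "\<forall>b\<in>D. g b \<le> int C" and p: "p \<in> lists D"
    and "c \<in> lists D" "sum_list (map g c) > int (card (f ` lists D) * C)"
  shows "\<exists>c'\<in>lists D. f (p @ c') = f (p @ c) \<and> sum_list (map g c') \<ge> K"
  using assms(5,6)
proof (induction "length c" arbitrary: c rule: less_induct)
  case less
  let ?g = "\<lambda>c. sum_list (map g c)"
  have "?g c \<le> (\<Sum>b\<leftarrow>c. int C)"
    using less.prems(1) g by (intro sum_list_mono) auto
  also have "\<dots> = int (length c * C)" by (simp add: sum_list_triv)
  finally have "int (card (f ` lists D) * C) < int (length c * C)"
    using less.prems(2) by linarith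
  then have "card (f ` lists D) < length c"
    by (metis mult_le_mono1 not_less of_nat_less_iff)
  moreover have "card ((\<lambda>i. f (p @ take i c)) ` {..length c}) \<le> card (f ` lists D)"
    using fin p less.prems(1) by (intro card_mono image_subsetI imageI) (auto dest: in_set_takeD)
  ultimately have "card ((\<lambda>i. f (p @ take i c)) ` {..length c}) < card {..length c}"
    by simp
  then have "\<not> inj_on (\<lambda>i. f (p @ take i c)) {..length c}" by (rule pigeonhole)
  then obtain i j where ij: "i < j" "j \<le> length c" "f (p @ take i c) = f (p @ take j c)"
    unfolding inj_on_def by (metis atMost_iff linorder_neqE_nat)
  define s u t where "s = take i c" and "u = take (j - i) (drop i c)" and "t = drop j c"
  have tj: "take j c = s @ u"
    using ij(1) by (metis s_def u_def take_add le_add_diff_inverse less_imp_le)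
  have c: "c = s @ u @ t"
    using tj by (metis append_assoc append_take_drop_id t_def)
  have len: "length u > 0" using ij by (simp add: u_def)
  have D: "s \<in> lists D" "u \<in> lists D" "t \<in> lists D" using less.prems(1) c by auto
  have loop: "f ((p @ s) @ u) = f (p @ s)" using ij(3) tj by (simp add: s_def)
  show ?case
  proof (cases "?g u > 0")
    case True
    define n where "n = nat (K - ?g s - ?g t)"
    let ?c = "s @ concat (replicate n u) @ t"
    have "?g (concat (replicate n u)) = int n * ?g u"
      by (induction n) (auto simp: algebra_simps)
    moreover have "int n * ?g u \<ge> int n * 1" using True by (intro mult_left_mono) auto
    moreover have "K - ?g s - ?g t \<le> int n" by (simp add: n_def)
    ultimately have "?g ?c \<ge> K" by simp
    moreover have "f (((p @ s) @ concat (replicate n u)) @ t) = f (((p @ s) @ u) @ t)"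
      using D p loop right_invariant_loop[OF inv _ D(2) loop] concat_replicate_in_lists[OF D(2)]
      by (intro right_invariant_append[OF inv]) auto
    moreover have "?c \<in> lists D" using D concat_replicate_in_lists[OF D(2)] by simp
    ultimately show ?thesis by (intro bexI[of _ ?c]) (simp_all add: c)
  next
    case False
    have "\<exists>c'\<in>lists D. f (p @ c') = f (p @ (s @ t)) \<and> ?g c' \<ge> K"
      using less.prems(2) False len D by (intro less.hyps) (auto simp: c)
    moreover have "f (((p @ s) @ u) @ t) = f ((p @ s) @ t)"
      using D p loop by (intro right_invariant_append[OF inv]) auto
    ultimately show ?thesis by (simp add: c)
  qed
qed

section \<open>No recognizable language of normal forms\<close>

lemma height_concat: "height (concat (map \<rho> ws)) = (\<Sum>b\<leftarrow>ws. height (\<rho> b))"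
  by (induction ws) auto

text \<open>
  The automaton reads a word \<open>ws\<close> for a spiral with as many rounds as there are states, so two lower
  turning points \<open>V i\<close> and \<open>V j\<close> share their state. The loop \<open>c1 c2\<close> from the first to the second
  passes the upper turning point \<open>U i\<close>. It descends, while \<open>c1\<close> ascends far enough to be replaced by a
  path \<open>c'\<close> for which \<open>c' c2\<close> ascends. The lower bound on \<open>N\<close> makes the swings dominate both the
  rounding error \<open>2 C\<close> and the gain of a repetition-free path.
\<close>

lemma zero_height_loop:
  fixes a :: 'a
  assumes inv: "right_invariant D f" and fin: "finite (f ` lists D)"
    and C: "\<forall>b\<in>D. length (\<rho> b) \<le> C" and ws: "ws \<in> lists D"
    and N: "N > card (f ` lists D) * C + 2 * C"
    and cong: "(concat (map \<rho> ws), spiral a N (card (f ` lists D))) \<in> star_cong A"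
  shows "\<exists>x y z. x \<in> lists D \<and> y \<in> lists D \<and> z \<in> lists D \<and> y \<noteq> [] \<and>
    height (concat (map \<rho> y)) = 0 \<and> f (x @ y) = f x \<and> f (x @ z) = f ws"
proof -
  let ?h = "\<lambda>v. height (concat (map \<rho> v))"
  define m where "m = card (f ` lists D)"
  have "\<forall>S\<in>explored {0} 0 (spiral a N m). alternating N S"
    using alternating_spiral N by (metis not_less_zero neq0_conv)
  then have alt: "\<forall>S\<in>explored {0} 0 (concat (map \<rho> ws)). alternating N S"
    using star_cong_invariants[OF cong, of 0] by (simp add: m_def)
  have prefix: "prefix (concat (map \<rho> ws) @ []) (concat (map \<rho> ws))" by simp
  have height: "height (concat (map \<rho> ws) @ []) = - int (m * N)"
    using star_cong_invariants[OF cong] by (simp add: m_def height_spiral)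
  have lengths: "\<forall>b\<in>set ws. length (\<rho> b) \<le> C" "length ([] :: ('a + 'a) list) \<le> C"
    using C ws by auto
  obtain V U where Vm: "V m = ws"
    and hV: "\<And>i. i \<le> m \<Longrightarrow> \<bar>?h (V i) + int (i * N)\<bar> \<le> int C"
    and VU: "\<And>i. i < m \<Longrightarrow> prefix (V i) (U i)" "\<And>i. i < m \<Longrightarrow> prefix (U i) (V (Suc i))"
    and hU: "\<And>i. i < m \<Longrightarrow> \<bar>?h (U i) - int (Suc i * N)\<bar> \<le> int C"
    using alternating_generator_prefixes[OF alt prefix height lengths] by blast
  have mono: "prefix (V i) (V j)" if "i \<le> j" "j \<le> m" for i j
    using that
  proof (induction rule: dec_induct)
    case (step j)
    then show ?case using VU[of j] by (auto intro: prefix_order.trans)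
  qed simp
  have VD: "V i \<in> lists D" if "i \<le> m" for i
    using mono[OF that] ws set_mono_prefix unfolding Vm by fastforce
  have "card ((\<lambda>i. f (V i)) ` {..m}) \<le> m"
    unfolding m_def using fin VD by (intro card_mono image_subsetI imageI) (auto simp: m_def)
  then have "card ((\<lambda>i. f (V i)) ` {..m}) < card {..m}" by simp
  then have "\<not> inj_on (\<lambda>i. f (V i)) {..m}" by (rule pigeonhole)
  then obtain i j where ij: "i < j" "j \<le> m" "f (V i) = f (V j)"
    unfolding inj_on_def by (metis atMost_iff linorder_neqE_nat)
  obtain c1 where c1: "U i = V i @ c1"
    using VU(1)[of i] ij by (auto simp: prefix_def)
  have "prefix (U i) (V j)"
    using VU(2)[of i] mono[of "Suc i" j] ij by (auto intro: prefix_order.trans)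
  then obtain c2 where c2: "V j = (V i @ c1) @ c2"
    by (auto simp: prefix_def c1)
  obtain z where z: "ws = V j @ z"
    using mono[of j m] ij unfolding Vm by (auto simp: prefix_def)
  have D: "V i \<in> lists D" "c1 \<in> lists D" "c2 \<in> lists D" "z \<in> lists D"
    using VD[OF ij(2)] ws by (auto simp: c2 z)
  have mN: "int m * int C + 2 * int C < int N"
    using N unfolding m_def by (metis of_nat_add of_nat_less_iff of_nat_mult of_nat_numeral)
  have mC: "0 \<le> int m * int C" by simp
  have mult_le: "int (i * N) + int N \<le> int (j * N)"
    using ij(1) mult_le_mono1[of "Suc i" j N] by (simp flip: of_nat_add of_nat_mult)
  have h1: "int (m * C) < ?h c1"
    using hU[of i] hV[of i] ij mN unfolding c1 by (simp add: abs_le_iff algebra_simps)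
      (smt (verit) mult_nonneg_nonneg of_nat_0_le_iff)
  have h12: "?h c1 + ?h c2 < 0"
    using hV[of i] hV[OF ij(2)] ij(1,2) mN mC mult_le
    unfolding c2 map_append concat_append height_simps by linarith
  have gC: "\<forall>b\<in>D. height (\<rho> b) \<le> int C"
  proof
    fix b assume "b \<in> D"
    with C have "int (length (\<rho> b)) \<le> int C" by simp
    with abs_height_le[of "\<rho> b"] show "height (\<rho> b) \<le> int C" by linarith
  qed
  have h1': "int (card (f ` lists D) * C) < (\<Sum>b\<leftarrow>c1. height (\<rho> b))"
    using h1 by (simp add: m_def height_concat)
  obtain c' where c': "c' \<in> lists D" "f (V i @ c') = f (V i @ c1)" "?h c' \<ge> 1 - ?h c2"
    using raise_weight[OF inv fin gC D(1,2) h1', of "1 - ?h c2"] by (auto simp: height_concat)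
  define d e where "d = c1 @ c2" and "e = c' @ c2"
  have de: "d \<in> lists D" "e \<in> lists D" "?h d < 0" "?h e > 0"
    using D c' h12 by (auto simp: d_def e_def)
  have fd: "f (V i @ d) = f (V i)"
    using ij(3) by (simp add: d_def c2)
  have "f ((V i @ c') @ c2) = f ((V i @ c1) @ c2)"
    using D c' by (intro right_invariant_append[OF inv]) auto
  then have fe: "f (V i @ e) = f (V i)"
    using fd by (simp add: d_def e_def)
  \<comment> \<open>Repetition numbers that balance the descent of \<open>d\<close> against the ascent of \<open>e\<close>.\<close>
  define y where
    "y = concat (replicate (nat (?h e)) d) @ concat (replicate (nat (- ?h d)) e)"
  have rep: "?h (concat (replicate n c)) = int n * ?h c" for n c
    by (induction n) (auto simp: algebra_simps)
  have "?h y = 0"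
    using de by (simp add: y_def rep)
  moreover have "y \<noteq> []"
  proof -
    have "d \<noteq> []" using de by auto
    then show ?thesis using de by (simp add: y_def)
  qed
  moreover have "y \<in> lists D"
    using de concat_replicate_in_lists[of _ D] by (simp add: y_def)
  moreover have "f (V i @ y) = f (V i)"
  proof -
    have "f ((V i @ concat (replicate (nat (?h e)) d)) @ concat (replicate (nat (- ?h d)) e)) =
        f (V i @ concat (replicate (nat (- ?h d)) e))"
      using D de concat_replicate_in_lists[of _ D] right_invariant_loop[OF inv D(1) de(1) fd]
      by (intro right_invariant_append[OF inv]) auto
    then show ?thesis
      using right_invariant_loop[OF inv D(1) de(2) fe] by (simp add: y_def)
  qed
  moreover have "f (V i @ z) = f ws"
    unfolding z using D VD[OF ij(2)] ij(3) by (intro right_invariant_append[OF inv])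
  ultimately show ?thesis using D by blast
qed

lemma visited_power_subset:
  assumes "height c = 0"
  shows "visited h (concat (replicate n c)) \<subseteq> visited h c"
  by (induction n) (simp_all add: visited_append assms)

text \<open>
  In rank greater than one, only the generators in \<open>D\<close>, which are words in one letter and its star,
  can occur in a representative of the spiral. The pumped words consist of the same generators,
  so \<open>finite_classes_bounded_range\<close> applies to them.
\<close>

lemma no_recognizable_length_section:
  fixes A :: "'a set" and f :: "('a + 'a) list set list \<Rightarrow> 'q"
  defines "M \<equiv> free_regular_star_monoid A"
  assumes a: "a \<in> A" and gen: "finite_generating_set M B" and L: "L \<subseteq> lists B"
    and fin: "finite (f ` lists B)" and inv: "right_invariant B f"
    and sat: "\<And>u v. u \<in> lists B \<Longrightarrow> v \<in> lists B \<Longrightarrow> f u = f v \<Longrightarrow> u \<in> L \<longleftrightarrow> v \<in> L"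
    and surj: "\<And>m. m \<in> carrier M \<Longrightarrow> \<exists>w\<in>L. word_value M w = m"
    and len: "\<And>u v. u \<in> L \<Longrightarrow> v \<in> L \<Longrightarrow> word_value M u = word_value M v \<Longrightarrow> length u = length v"
  shows False
proof -
  let ?cls = "\<lambda>w. star_cong A `` {w}"
  have carrier_M: "carrier M = lists (A <+> A) // star_cong A"
    by (simp add: M_def free_regular_star_monoid_def presented_monoid_def)
  have BM: "B \<subseteq> carrier M" and finB: "finite B"
    using gen by (auto simp: finite_generating_set_def)
  have "\<forall>b\<in>B. \<exists>w. w \<in> lists (A <+> A) \<and> b = ?cls w"
    using BM unfolding carrier_M quotient_def by blast
  from bchoice[OF this] obtain \<rho> where
    "\<forall>b\<in>B. \<rho> b \<in> lists (A <+> A) \<and> b = ?cls (\<rho> b)" by (elim exE)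
  then have \<rho>: "\<And>b. b \<in> B \<Longrightarrow> \<rho> b \<in> lists (A <+> A)" "\<And>b. b \<in> B \<Longrightarrow> b = ?cls (\<rho> b)"
    by (simp_all only:)
  have spell: "concat (map \<rho> ws) \<in> lists (A <+> A) \<and> word_value M ws = ?cls (concat (map \<rho> ws))"
    if "ws \<in> lists B" for ws
    using that
  proof (induction ws)
    case Nil
    show ?case
      by (simp add: word_value_def M_def free_regular_star_monoid_def presented_monoid_def)
  next
    case (Cons b ws)
    have "word_value M (b # ws) = b \<otimes>\<^bsub>M\<^esub> word_value M ws"
      by (simp add: word_value_def)
    also have "\<dots> = ?cls (\<rho> b) \<otimes>\<^bsub>M\<^esub> ?cls (concat (map \<rho> ws))"
      using Cons \<rho>(2)[of b] by simp
    also have "\<dots> = ?cls (\<rho> b @ concat (map \<rho> ws))"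
      unfolding M_def free_regular_star_monoid_def
      using Cons \<rho>(1) by (intro presented_monoid_mult) auto
    finally show ?case using Cons \<rho>(1) by simp
  qed

  define D where "D = {b \<in> B. \<rho> b \<in> lists {Inl a, Inr a}}"
  have DB: "lists D \<subseteq> lists B" by (intro lists_mono) (auto simp: D_def)
  have finD: "finite (f ` lists D)"
    using fin DB by (meson finite_subset image_mono)
  have invD: "right_invariant D f"
    using inv DB unfolding right_invariant_def D_def by blast
  have "finite ((\<lambda>b. length (\<rho> b)) ` D)" using finB by (simp add: D_def)
  then obtain C where C: "\<forall>b\<in>D. length (\<rho> b) \<le> C"
    unfolding finite_nat_set_iff_bounded_le by auto
  define N where "N = card (f ` lists D) * C + 2 * C + 1"
  define \<sigma> where "\<sigma> = spiral a N (card (f ` lists D))"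
  have \<sigma>X: "\<sigma> \<in> lists {Inl a, Inr a}" unfolding \<sigma>_def by (rule spiral_in_lists)
  then have \<sigma>A: "\<sigma> \<in> lists (A <+> A)" using a by auto
  then have "?cls \<sigma> \<in> carrier M" unfolding carrier_M by (rule quotientI)
  from surj[OF this] obtain ws where ws: "ws \<in> L" "word_value M ws = ?cls \<sigma>" by blast
  have wsB: "ws \<in> lists B" using ws(1) L by blast
  have cong: "(concat (map \<rho> ws), \<sigma>) \<in> star_cong A"
    using spell[OF wsB] ws(2) \<sigma>A by (intro eq_equiv_class[OF _ equiv_pres_cong]) auto
  have "concat (map \<rho> ws) \<in> lists {Inl a, Inr a}"
    using \<sigma>X star_cong_invariants[OF cong] by (simp flip: content_subset_singleton)
  then have wsD: "ws \<in> lists D"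
    using wsB unfolding D_def by auto
  have "N > card (f ` lists D) * C + 2 * C" by (simp add: N_def)
  from zero_height_loop[OF invD finD C wsD this cong[unfolded \<sigma>_def]] obtain x y z where
    D: "x \<in> lists D" "y \<in> lists D" "z \<in> lists D" and y: "y \<noteq> []"
    and hy: "height (concat (map \<rho> y)) = 0" and loop: "f (x @ y) = f x" and z: "f (x @ z) = f ws"
    by blast

  define w where "w n = x @ concat (replicate n y) @ z" for n
  have wD: "w n \<in> lists D" for n
    using D concat_replicate_in_lists[OF D(2)] by (simp add: w_def)
  have "f (w n) = f ws" for n
  proof -
    have "f ((x @ concat (replicate n y)) @ z) = f (x @ z)"
      using D concat_replicate_in_lists[OF D(2)] right_invariant_loop[OF invD D(1,2) loop]
      by (intro right_invariant_append[OF invD]) auto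
    with z show ?thesis by (simp add: w_def)
  qed
  then have wL: "w n \<in> L" for n
    using sat[of "w n" ws] wD DB wsB ws(1) by blast

  let ?s = "\<lambda>v. concat (map \<rho> v)"
  define S where "S = visited 0 (?s x) \<union> visited (height (?s x)) (?s y) \<union> visited (height (?s x)) (?s z)"
  have pow: "?s (concat (replicate n y)) = concat (replicate n (?s y))" for n
    by (induction n) auto
  have hpow: "height (concat (replicate n (?s y))) = 0" for n
    by (induction n) (auto simp: hy)
  have "visited 0 (?s (w n)) \<subseteq> S" for n
    using visited_power_subset[OF hy, of "height (?s x)" n]
    by (auto simp: w_def S_def visited_append pow hpow)
  moreover have "?s v \<in> lists {Inl a, Inr a}" if "v \<in> lists D" for v
    using that by (induction v) (auto simp: D_def)
  ultimately have sub: "range (\<lambda>n. ?cls (?s (w n))) \<subseteq>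
      ?cls ` {v \<in> lists {Inl a, Inr a}. visited 0 v \<subseteq> S}"
    using wD by blast
  have "finite S" by (simp add: S_def)
  from finite_subset[OF sub finite_classes_bounded_range[OF a this]]
  have "\<not> inj (\<lambda>n. ?cls (?s (w n)))"
    using finite_imageD infinite_UNIV_nat by blast
  then obtain k l where kl: "k \<noteq> l" "?cls (?s (w k)) = ?cls (?s (w l))"
    unfolding inj_on_def by blast
  have wB: "w n \<in> lists B" for n
    using wD DB by blast
  have "word_value M (w k) = word_value M (w l)"
    using spell[OF wB[of k]] spell[OF wB[of l]] kl(2) by simp
  from len[OF wL wL this] have "k * length y = l * length y"
    by (simp add: w_def length_concat sum_list_replicate)
  with kl(1) y show False by simp
qed

lemma regular_languageE:
  assumes "regular_language S L"
  obtains Q :: "nat set" and i d F where "finite Q" "i \<in> Q" "\<forall>q\<in>Q. \<forall>s\<in>S. d q s \<in> Q"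
    "L = {w \<in> lists S. foldl d i w \<in> F}"
  using assms unfolding regular_language_def by (elim exE conjE) (rule that)

lemma foldl_in_states:
  assumes "i \<in> Q" "\<forall>q\<in>Q. \<forall>s\<in>S. d q s \<in> Q" "w \<in> lists S"
  shows "foldl d i w \<in> Q"
  using assms(3) by (induction w rule: rev_induct) (use assms(1,2) in auto)

lemma not_rational:
  assumes "a \<in> A"
  shows "\<not> rational_monoid (free_regular_star_monoid A)"
proof
  let ?M = "free_regular_star_monoid A"
  assume "rational_monoid ?M"
  then obtain B L where gen: "finite_generating_set ?M B" and reg: "regular_language B L"
    and uniq: "\<forall>m\<in>carrier ?M. \<exists>!w. w \<in> L \<and> word_value ?M w = m"
    unfolding rational_monoid_def by (elim exE conjE) (rule that)
  from reg obtain Q :: "nat set" and i d F where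
    dfa: "finite Q" "i \<in> Q" "\<forall>q\<in>Q. \<forall>s\<in>B. d q s \<in> Q" "L = {w \<in> lists B. foldl d i w \<in> F}"
    by (rule regular_languageE) (rule that)
  have run: "foldl d i w \<in> Q" if "w \<in> lists B" for w
    using dfa(2,3) that by (rule foldl_in_states)
  have val: "word_value ?M w \<in> carrier ?M" if "w \<in> L" for w
    using that gen dfa(4) by (auto simp: finite_generating_set_def)
  show False
  proof (rule no_recognizable_length_section[OF assms gen, of L "foldl d i"])
    show "finite (foldl d i ` lists B)"
      using dfa(1) run by (meson finite_subset image_subsetI)
    show "right_invariant B (foldl d i)"
      by (simp add: right_invariant_def)
    show "\<exists>w\<in>L. word_value ?M w = m" if "m \<in> carrier ?M" for m
      using bspec[OF uniq that] by blast
    show "length u = length v" if "u \<in> L" "v \<in> L" "word_value ?M u = word_value ?M v" for u v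
      using bspec[OF uniq val[OF that(1)]] that by metis
  qed (use dfa(4) in auto)
qed

section \<open>Shortest representatives in an automatic structure\<close>

text \<open>
  Either word is recovered by dropping the padding symbols of its tape.
\<close>

lemma inj_padded_pair:
  assumes "padded_pair u v = padded_pair u' v'"
  shows "u = u' \<and> v = v'"
proof -
  have fst: "concat (map (\<lambda>p. case fst p of None \<Rightarrow> [] | Some s \<Rightarrow> [s]) (padded_pair u v)) = u" for u v :: "'s list"
  proof -
    have "map fst (padded_pair u v) = map Some u @ replicate (length v - length u) None"
      unfolding padded_pair_def by (rule map_fst_zip) auto
    then have "map (\<lambda>p. case fst p of None \<Rightarrow> [] | Some s \<Rightarrow> [s]) (padded_pair u v) =
        map (case_option [] (\<lambda>s. [s])) (map Some u @ replicate (length v - length u) None)"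
      by (metis (no_types, lifting) list.map_comp comp_apply map_eq_conv)
    then show ?thesis by (simp add: comp_def)
  qed
  have swap: "padded_pair v u = map prod.swap (padded_pair u v)" for u v :: "'s list"
    unfolding padded_pair_def by (subst zip_commute) auto
  show ?thesis using assms fst swap by metis
qed

lemma padded_pair_in_lists:
  assumes "u \<in> lists S" "v \<in> lists S"
  shows "padded_pair u v \<in> lists (insert None (Some ` S) \<times> insert None (Some ` S))"
  unfolding in_lists_conv_set
proof
  fix p assume "p \<in> set (padded_pair u v)"
  moreover obtain s t where p: "p = (s, t)" by (cases p)
  ultimately have st: "(s, t) \<in> set (zip (map Some u @ replicate (length v - length u) None)
      (map Some v @ replicate (length u - length v) None))"
    by (simp add: padded_pair_def)
  have "s \<in> insert None (Some ` S)"
    using set_zip_leftD[OF st] assms(1) by (auto split: if_splits)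
  moreover have "t \<in> insert None (Some ` S)"
    using set_zip_rightD[OF st] assms(2) by (auto split: if_splits)
  ultimately show "p \<in> insert None (Some ` S) \<times> insert None (Some ` S)"
    unfolding p by (rule SigmaI)
qed

lemma padded_pair_snoc_longer:
  fixes u v :: "'a list"
  assumes "length v \<le> length u"
  shows "padded_pair (u @ [s]) v = padded_pair u v @ [(Some s, None)]"
proof -
  have "replicate (Suc (length u) - length v) (None :: 'a option)
      = replicate (length u - length v) None @ [None]"
    using assms by (simp add: Suc_diff_le replicate_append_same)
  moreover have "zip (map Some u @ [Some s])
      ((map Some v @ replicate (length u - length v) None) @ [None]) =
    zip (map Some u) (map Some v @ replicate (length u - length v) None) @ [(Some s, None)]"
    using assms by (subst zip_append) simp_all
  ultimately show ?thesis
    using assms by (simp add: padded_pair_def)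
qed

lemma padded_pair_snoc_equal:
  assumes "length v = length u"
  shows "padded_pair (u @ [s]) (v @ [t]) = padded_pair u v @ [(Some s, Some t)]"
  using assms by (simp add: padded_pair_def)

lemma words_of_length_Suc:
  "{v \<in> lists B. length v = Suc n} = (\<Union>t\<in>B. (\<lambda>v. v @ [t]) ` {v \<in> lists B. length v = n})"
proof (rule Set.set_eqI)
  fix v
  show "v \<in> {v \<in> lists B. length v = Suc n} \<longleftrightarrow>
      v \<in> (\<Union>t\<in>B. (\<lambda>v. v @ [t]) ` {v \<in> lists B. length v = n})"
    by (cases v rule: rev_cases) auto
qed

text \<open>
  The map \<open>f\<close> pairs the state of the automaton for \<open>L\<close> with the sets of states that the automaton for
  equality can reach on \<open>u\<close> and some \<open>v\<close> of the same, respectively of smaller, length. The first set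
  is needed to update the second: a word as long as \<open>u\<close> becomes shorter once \<open>u\<close> is extended.
\<close>

lemma not_automatic:
  assumes "a \<in> A"
  shows "\<not> automatic_monoid (free_regular_star_monoid A)"
proof
  let ?M = "free_regular_star_monoid A"
  assume "automatic_monoid ?M"
  then obtain B L where gen: "finite_generating_set ?M B" and reg: "regular_language B L"
    and surj: "\<forall>m\<in>carrier ?M. \<exists>w\<in>L. word_value ?M w = m"
    and syns: "\<forall>x\<in>insert \<one>\<^bsub>?M\<^esub> B. synchronous_rational B
      {(u, v). u \<in> L \<and> v \<in> L \<and> word_value ?M u \<otimes>\<^bsub>?M\<^esub> x = word_value ?M v}"
    unfolding automatic_monoid_def by (elim exE conjE) (rule that)
  have syn: "synchronous_rational B
      {(u, v). u \<in> L \<and> v \<in> L \<and> word_value ?M u \<otimes>\<^bsub>?M\<^esub> \<one>\<^bsub>?M\<^esub> = word_value ?M v}"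
    using syns by (rule bspec) simp
  interpret monoid ?M
    unfolding free_regular_star_monoid_def by (rule monoid_presented_monoid)
  from reg obtain Q :: "nat set" and i d F where
    dfa: "finite Q" "i \<in> Q" "\<forall>q\<in>Q. \<forall>s\<in>B. d q s \<in> Q" "L = {w \<in> lists B. foldl d i w \<in> F}"
    by (rule regular_languageE) (rule that)
  define P where "P = {(u, v). u \<in> L \<and> v \<in> L \<and> word_value ?M u = word_value ?M v}"
  let ?B2 = "insert None (Some ` B) \<times> insert None (Some ` B)"
  have val: "word_value ?M w \<in> carrier ?M" if "w \<in> L" for w
    using that gen dfa(4) by (auto simp: finite_generating_set_def)
  have "P = {(u, v). u \<in> L \<and> v \<in> L \<and> word_value ?M u \<otimes>\<^bsub>?M\<^esub> \<one>\<^bsub>?M\<^esub> = word_value ?M v}"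
    using val by (auto simp: P_def)
  with syn have "regular_language ?B2 {padded_pair u v |u v. (u, v) \<in> P}"
    by (simp add: synchronous_rational_def)
  then obtain Q' :: "nat set" and i' d' F' where
    dfa': "finite Q'" "i' \<in> Q'" "\<forall>q\<in>Q'. \<forall>s\<in>?B2. d' q s \<in> Q'"
      "{padded_pair u v |u v. (u, v) \<in> P} = {w \<in> lists ?B2. foldl d' i' w \<in> F'}"
    by (rule regular_languageE) (rule that)
  have run: "foldl d i w \<in> Q" if "w \<in> lists B" for w
    using dfa(2,3) that by (rule foldl_in_states)
  have run': "foldl d' i' w \<in> Q'" if "w \<in> lists ?B2" for w
    using dfa'(2,3) that by (rule foldl_in_states)
  have accept: "foldl d' i' (padded_pair u v) \<in> F' \<longleftrightarrow> (u, v) \<in> P"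
    if "u \<in> lists B" "v \<in> lists B" for u v
  proof -
    have "foldl d' i' (padded_pair u v) \<in> F' \<longleftrightarrow>
        padded_pair u v \<in> {w \<in> lists ?B2. foldl d' i' w \<in> F'}"
      using padded_pair_in_lists[OF that] by simp
    also have "\<dots> \<longleftrightarrow> (\<exists>u' v'. padded_pair u v = padded_pair u' v' \<and> (u', v') \<in> P)"
      unfolding dfa'(4)[symmetric] by simp
    also have "\<dots> \<longleftrightarrow> (u, v) \<in> P"
      using inj_padded_pair by metis
    finally show ?thesis .
  qed

  define same where
    "same u = (\<lambda>v. foldl d' i' (padded_pair u v)) ` {v \<in> lists B. length v = length u}" for u
  define shorter where
    "shorter u = (\<lambda>v. foldl d' i' (padded_pair u v)) ` {v \<in> lists B. length v < length u}" for u
  define f where "f u = (foldl d i u, same u, shorter u)" for u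
  define L' where "L' = {u \<in> L. \<forall>v\<in>L. word_value ?M u = word_value ?M v \<longrightarrow> length u \<le> length v}"

  have same_snoc: "same (u @ [s]) = (\<Union>t\<in>B. (\<lambda>q. d' q (Some s, Some t)) ` same u)" for u s
    unfolding same_def length_append_singleton words_of_length_Suc image_UN image_image
    by (intro SUP_cong image_cong refl) (simp_all add: padded_pair_snoc_equal)
  have shorter_snoc: "shorter (u @ [s]) = (\<lambda>q. d' q (Some s, None)) ` (same u \<union> shorter u)" for u s
  proof -
    have split: "{v \<in> lists B. length v < length (u @ [s])} =
        {v \<in> lists B. length v = length u} \<union> {v \<in> lists B. length v < length u}"
      by auto
    show ?thesis
      unfolding same_def shorter_def split image_Un image_image
      by (intro arg_cong2[of _ _ _ _ "(\<union>)"] image_cong refl) (simp_all add: padded_pair_snoc_longer)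
  qed
  have shortest: "u \<in> L' \<longleftrightarrow> foldl d i u \<in> F \<and> shorter u \<inter> F' = {}" if u: "u \<in> lists B" for u
  proof -
    have "shorter u \<inter> F' = {} \<longleftrightarrow> (\<forall>q\<in>shorter u. q \<notin> F')" by blast
    also have "\<dots> \<longleftrightarrow> (\<forall>v\<in>lists B. length v < length u \<longrightarrow> (u, v) \<notin> P)"
      unfolding shorter_def using accept[OF u] by auto
    finally have "shorter u \<inter> F' = {} \<longleftrightarrow>
        (\<forall>v\<in>lists B. length v < length u \<longrightarrow> (u, v) \<notin> P)" .
    moreover have "u \<in> L \<longleftrightarrow> foldl d i u \<in> F" using u dfa(4) by simp
    moreover have "L \<subseteq> lists B" using dfa(4) by blast
    then have "u \<in> L' \<longleftrightarrow> u \<in> L \<and> (\<forall>v\<in>lists B. length v < length u \<longrightarrow> (u, v) \<notin> P)"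
      unfolding L'_def P_def mem_Collect_eq prod.case by (meson not_le subsetD)
    ultimately show ?thesis by simp
  qed
  show False
  proof (rule no_recognizable_length_section[OF assms gen, of L' f])
    show "L' \<subseteq> lists B" using dfa(4) by (auto simp: L'_def)
    have "f u \<in> Q \<times> Pow Q' \<times> Pow Q'" if "u \<in> lists B" for u
      using that run run'[OF padded_pair_in_lists] by (simp add: f_def same_def shorter_def image_subset_iff)
    then have "f ` lists B \<subseteq> Q \<times> Pow Q' \<times> Pow Q'" by (rule image_subsetI)
    then show "finite (f ` lists B)"
      by (rule finite_subset) (simp add: dfa(1) dfa'(1))
    show "right_invariant B f"
      by (simp add: right_invariant_def f_def same_snoc shorter_snoc)
    show "u \<in> L' \<longleftrightarrow> v \<in> L'" if "u \<in> lists B" "v \<in> lists B" "f u = f v" for u v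
      using that by (simp add: shortest f_def)
    show "\<exists>w\<in>L'. word_value ?M w = m" if m: "m \<in> carrier ?M" for m
    proof -
      obtain w where "w \<in> L \<and> word_value ?M w = m" using bspec[OF surj m] by blast
      then obtain v where v: "v \<in> L \<and> word_value ?M v = m"
        and least: "\<forall>y. y \<in> L \<and> word_value ?M y = m \<longrightarrow> length v \<le> length y"
        using ex_has_least_nat[of "\<lambda>w. w \<in> L \<and> word_value ?M w = m" w length] by blast
      have "v \<in> L'" unfolding L'_def mem_Collect_eq using v least by simp
      with v show ?thesis by blast
    qed
    show "length u = length v" if "u \<in> L'" "v \<in> L'" "word_value ?M u = word_value ?M v" for u v
    proof (rule antisym)
      show "length u \<le> length v" "length v \<le> length u"
        using that unfolding L'_def by simp_all
    qed
  qed
qed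

theorem corollary2p1:
  fixes A :: "'a set" and r :: nat
  assumes "r \<ge> 1" and "finite A" and "card A = r"
  shows "\<not> rational_monoid (free_regular_star_monoid A)
       \<and> \<not> automatic_monoid (free_regular_star_monoid A)"
proof -
  have "A \<noteq> {}" using assms by auto
  then obtain a where "a \<in> A" by blast
  then show ?thesis by (intro conjI not_rational not_automatic)
qed

end
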